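(* For any $0<\delta\le 1$ there exists $\gamma=\gamma(\delta)>0$ such that for any positive integer $n$ and any $0<\epsilon<1$ there exists a polynomial $p=p_{n,\delta,\epsilon}$ in the entries $a_{ij}$ of a $2n\times 2n$ symmetric matrix $A$ such that $\deg p\le\gamma(\ln n-\ln\epsilon)$ and $$\left|\ln\operatorname{haf}A-p(A)\right|\le\epsilon$$ for all $2n\times 2n$ real symmetric matrices $A=(a_{ij})$ satisfying $\delta\le a_{ij}\le 1$ for all $i,j$.
   Context: The hafnian of a $2n\times 2n$ symmetric real or complex matrix $A=(a_{ij})$ is $\operatorname{haf}A=\sum a_{i_1j_1}\cdots a_{i_nj_n}$, where the sum is over all $(2n)!/(2^n n!)$ unordered partitions of $\{1,\dots,2n\}$ into $n$ pairwise disjoint unordered pairs $\{i_1,j_1\},\dots,\{i_n,j_n\}$.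
   Formalization: For n = 1 the degree bound is γ(1 − ln ε) instead of γ(ln n − ln ε), since the latter fails for δ ≤ e^{-2} and ε near 1 (it forces p constant while ln a_12 varies by at least 2); for n ≥ 2 the bound is as stated. *)

theory Defs
  imports Complex_Main "HOL-Library.Disjoint_Sets" "HOL-Library.Poly_Mapping"
    "Jordan_Normal_Form.Matrix"
begin

section \<open>Hafnians\<close>

definition pair_partitions :: "'a set \<Rightarrow> 'a set set set" where
  "pair_partitions S = {P. partition_on S P \<and> (\<forall>e\<in>P. card e = 2)}"

text \<open>Indices run over \<open>0, \<dots>, dim_row A - 1\<close>. An unordered pair \<open>{i, j}\<close> with \<open>i < j\<close>
  contributes \<open>a\<^sub>i\<^sub>j\<close>; for symmetric \<open>A\<close>, the only matrices for which the hafnian is meant,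
  \<open>a\<^sub>j\<^sub>i\<close> is the same entry.\<close>

definition hafnian :: "'a :: comm_semiring_1 mat \<Rightarrow> 'a" where
  "hafnian A = (\<Sum>P\<in>pair_partitions {0..<dim_row A}. \<Prod>e\<in>P. A $$ (Min e, Max e))"

section \<open>Multivariate polynomials\<close>

text \<open>A monomial maps each variable to its exponent, a polynomial maps each monomial to its
  coefficient.\<close>

type_synonym ('v, 'a) mpoly = "('v \<Rightarrow>\<^sub>0 nat) \<Rightarrow>\<^sub>0 'a"

definition mpoly_vars :: "('v, 'a :: zero) mpoly \<Rightarrow> 'v set" where
  "mpoly_vars p = (\<Union>m\<in>Poly_Mapping.keys p. Poly_Mapping.keys m)"

text \<open>The total degree; the zero polynomial gets degree \<open>0\<close>, like constants.\<close>

definition mpoly_degree :: "('v, 'a :: zero) mpoly \<Rightarrow> nat" where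
  "mpoly_degree p = Max (insert 0 ((\<lambda>m. \<Sum>v\<in>Poly_Mapping.keys m. Poly_Mapping.lookup m v) ` Poly_Mapping.keys p))"

definition mpoly_eval :: "('v \<Rightarrow> 'a) \<Rightarrow> ('v, 'a :: comm_semiring_1) mpoly \<Rightarrow> 'a" where
  "mpoly_eval x p = (\<Sum>m\<in>Poly_Mapping.keys p. Poly_Mapping.lookup p m * (\<Prod>v\<in>Poly_Mapping.keys m. x v ^ Poly_Mapping.lookup m v))"

end

theory Submission
  imports Defs "HOL-Complex_Analysis.Complex_Analysis"
begin

text \<open>Join the all-ones matrix \<open>J\<close> to \<open>A\<close> by the path \<open>J + s (A - J)\<close>, \<open>0 \<le> s \<le> 1\<close>. The logarithm of the
  hafnian can be continued along this path and approximated by its Taylor polynomial at \<open>J\<close>, provided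
  that the hafnian has no zeros for complex \<open>s\<close> near \<open>[0, 1]\<close>.

  The absence of zeros (\<open>matching_sum_nonzero\<close>) holds for all complex matrices whose entries lie in a
  thin rectangle around \<open>[\<delta>, 1]\<close>. The inductive statement is stronger than nonvanishing: hafnians of
  two submatrices that arise by deleting one index each from the same odd index set enclose an acute
  angle (\<open>matching_sums_acute\<close>). Row expansion writes two such hafnians as combinations of the same
  smaller hafnians, which pairwise enclose acute angles by induction. Vectors of this kind cannot
  cancel substantially, so the small imaginary parts of the coefficients do not matter
  (\<open>acute_combination\<close>). The width of the rectangle depends on \<open>\<delta>\<close> only.

  A Taylor expansion in \<open>s\<close> at \<open>0\<close> need not reach \<open>s = 1\<close>, as there may be zeros off the segment
  \<open>[0, 1]\<close> whose modulus is less than \<open>1\<close>. Therefore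
  substitute \<open>s = \<phi>(z)\<close>, where \<open>\<phi>\<close> maps a disk of radius greater than \<open>1\<close> into a thin strip around
  \<open>[0, 1]\<close> with \<open>\<phi>(0) = 0\<close> and \<open>\<phi>(1) = 1\<close> (\<open>strip_map_bounds\<close>). Let \<open>G\<close> be a logarithm of
  \<open>haf (J + \<phi>(z) (A - J)) / haf J\<close> on this disk. Its real part is less than \<open>n\<close>, so the inequalities of
  Borel-Caratheodory and Cauchy make its Taylor coefficients at most \<open>C n / r\<^sup>k\<close> for some \<open>r > 1\<close>
  (\<open>coeff_bound_of_Re_bound\<close>). Truncation at order \<open>d\<close> then changes \<open>G(1)\<close> by at most \<open>\<epsilon>\<close> already for
  some \<open>d\<close> of order \<open>ln n - ln \<epsilon>\<close> (\<open>hafnian_log_truncation\<close>).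

  Finally, the \<open>k\<close>-th Taylor coefficient of \<open>G\<close> is a polynomial of degree at most \<open>k\<close> in the entries
  of \<open>A\<close> (\<open>graded_hafnian_series\<close>, \<open>graded_fps_log\<close>): because \<open>\<phi>(0) = 0\<close>, each entry comes with
  at least one factor of \<open>z\<close>, and taking the logarithm of a power series preserves this. The
  coefficients of the polynomial are real since those of \<open>\<phi>\<close> are.\<close>

section \<open>Sums over perfect matchings\<close>

text \<open>The hafnian with its matrix replaced by a weight on edges and its index range by any set.
  The induction behind the zero-free region removes vertices, which is awkward for matrices, and the
  coefficients may as well be complex numbers or power series.\<close>
definition matching_sum :: "('a set \<Rightarrow> 'b :: comm_semiring_1) \<Rightarrow> 'a set \<Rightarrow> 'b" where
  "matching_sum w S = (\<Sum>P\<in>pair_partitions S. \<Prod>e\<in>P. w e)"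

lemma finite_pair_partitions: "finite S \<Longrightarrow> finite (pair_partitions S)"
  unfolding pair_partitions_def
  by (rule finite_subset[OF _ finitely_many_partition_on[of S]]) auto

lemma matching_sum_empty [simp]: "matching_sum w ({} :: 'a set) = 1"
proof -
  have "pair_partitions ({} :: 'a set) = {{}}"
    by (auto simp: pair_partitions_def partition_on_empty)
  then show ?thesis by (simp add: matching_sum_def)
qed

lemma pair_partition_subset:
  "P \<in> pair_partitions S \<Longrightarrow> e \<in> P \<Longrightarrow> e \<subseteq> S"
  by (auto simp: pair_partitions_def partition_on_def)

lemma pair_partition_insert:
  assumes "x \<in> S" "y \<in> S" "x \<noteq> y" "Q \<in> pair_partitions (S - {x, y})"
  shows "insert {x, y} Q \<in> pair_partitions S"
proof -
  have "partition_on (S - {x, y}) Q" "\<forall>e\<in>Q. card e = 2"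
    using assms(4) by (auto simp: pair_partitions_def)
  moreover from this(1) have "disjnt {x, y} (\<Union>Q)"
    using partition_onD1[of "S - {x, y}" Q] by (simp add: disjnt_def flip: partition_onD1)
  ultimately show ?thesis
    using assms(1-3) by (simp add: pair_partitions_def partition_on_insert)
qed

text \<open>A perfect matching is determined by the partner \<open>y\<close> of a fixed vertex \<open>x\<close> together with a
  perfect matching of the remaining vertices.\<close>
lemma pair_partitions_split:
  assumes "x \<in> S"
  shows "pair_partitions S = (\<Union>y\<in>S - {x}. insert {x, y} ` pair_partitions (S - {x, y}))"
proof (intro equalityI subsetI)
  fix P assume P: "P \<in> pair_partitions S"
  then have part: "partition_on S P" and two: "\<forall>e\<in>P. card e = 2"
    by (auto simp: pair_partitions_def)
  from part assms obtain e where e: "e \<in> P" "x \<in> e"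
    by (auto simp: partition_on_def)
  with two obtain y where y: "e = {x, y}" "y \<noteq> x"
    by (metis card_2_iff doubleton_eq_iff insert_iff singletonD)
  have yS: "y \<in> S" using pair_partition_subset[OF P e(1)] y by auto
  define Q where "Q = P - {e}"
  have PQ: "P = insert {x, y} Q" using e y by (auto simp: Q_def)
  have "disjnt {x, y} (\<Union>Q)"
  proof -
    have "e \<inter> f = {}" if "f \<in> Q" for f
      using disjointD[OF partition_onD2[OF part] e(1)] that by (auto simp: Q_def)
    then show ?thesis unfolding y(1)[symmetric] disjnt_def by blast
  qed
  then have "partition_on (S - {x, y}) Q"
    using part unfolding PQ by (simp add: partition_on_insert)
  then have "Q \<in> pair_partitions (S - {x, y})"
    using two by (auto simp: pair_partitions_def Q_def)
  then show "P \<in> (\<Union>y\<in>S - {x}. insert {x, y} ` pair_partitions (S - {x, y}))"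
    using yS y(2) PQ by blast
next
  fix P assume "P \<in> (\<Union>y\<in>S - {x}. insert {x, y} ` pair_partitions (S - {x, y}))"
  then obtain y Q where y: "y \<in> S - {x}"
    and Q: "Q \<in> pair_partitions (S - {x, y})" "P = insert {x, y} Q"
    by (elim UN_E imageE)
  then show "P \<in> pair_partitions S"
    using pair_partition_insert[OF assms, of y Q] by auto
qed

text \<open>The row expansion of the hafnian along \<open>x\<close>.\<close>
lemma matching_sum_expand:
  assumes "finite S" "x \<in> S"
  shows "matching_sum w S = (\<Sum>y\<in>S - {x}. w {x, y} * matching_sum w (S - {x, y}))"
proof -
  let ?B = "\<lambda>y. insert {x, y} ` pair_partitions (S - {x, y})"
  have notin: "{x, z} \<notin> Q" if "Q \<in> pair_partitions (S - {x, y})" for y z Q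
    using pair_partition_subset[OF that] by blast
  have "matching_sum w S = (\<Sum>y\<in>S - {x}. \<Sum>P\<in>?B y. \<Prod>e\<in>P. w e)"
    unfolding matching_sum_def pair_partitions_split[OF assms(2)]
  proof (rule sum.UNION_disjoint)
    show "\<forall>i\<in>S - {x}. \<forall>j\<in>S - {x}. i \<noteq> j \<longrightarrow> ?B i \<inter> ?B j = {}"
    proof (intro ballI impI equals0I)
      fix i j P assume "i \<noteq> j" "P \<in> ?B i \<inter> ?B j"
      then obtain Q Q' where Q: "Q' \<in> pair_partitions (S - {x, j})"
          "insert {x, i} Q = insert {x, j} Q'"
        by auto
      then have "{x, i} \<in> insert {x, j} Q'" by blast
      with \<open>i \<noteq> j\<close> notin[OF Q(1)] show False by (auto simp: doubleton_eq_iff)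
    qed
  qed (use assms in \<open>auto intro!: finite_imageI finite_pair_partitions\<close>)
  also have "\<dots> = (\<Sum>y\<in>S - {x}. w {x, y} * matching_sum w (S - {x, y}))"
  proof (rule sum.cong[OF refl])
    fix y assume "y \<in> S - {x}"
    have "inj_on (insert {x, y}) (pair_partitions (S - {x, y}))"
      by (rule inj_onI) (metis insert_ident notin)
    then have "(\<Sum>P\<in>?B y. \<Prod>e\<in>P. w e)
        = (\<Sum>Q\<in>pair_partitions (S - {x, y}). \<Prod>e\<in>insert {x, y} Q. w e)"
      by (simp add: sum.reindex)
    also have "\<dots> = (\<Sum>Q\<in>pair_partitions (S - {x, y}). w {x, y} * (\<Prod>e\<in>Q. w e))"
    proof (rule sum.cong[OF refl])
      fix Q assume Q: "Q \<in> pair_partitions (S - {x, y})"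
      then have "finite Q"
        using assms(1) by (auto simp: pair_partitions_def intro: finite_elements[of "S - {x, y}"])
      then show "(\<Prod>e\<in>insert {x, y} Q. w e) = w {x, y} * (\<Prod>e\<in>Q. w e)"
        using notin[OF Q] by simp
    qed
    finally show "(\<Sum>P\<in>?B y. \<Prod>e\<in>P. w e) = w {x, y} * matching_sum w (S - {x, y})"
      by (simp add: matching_sum_def sum_distrib_left)
  qed
  finally show ?thesis .
qed

lemma card_pair_partition:
  assumes "finite S" "P \<in> pair_partitions S"
  shows "2 * card P = card S"
proof -
  have "card S = (\<Sum>e\<in>P. card e)"
    using assms by (intro product_partition) (auto simp: pair_partitions_def intro: card_ge_0_finite)
  also have "\<dots> = 2 * card P"
    using assms(2) by (simp add: pair_partitions_def)
  finally show ?thesis by simp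
qed

section \<open>A zero-free region for hafnians\<close>

text \<open>Plane vectors that pairwise enclose angles of at most \<open>\<pi>/2\<close> cannot cancel much: the left side
  is half the squared sum of their lengths, the right side the squared length of their sum. Since a
  cosine in \<open>[0, 1]\<close> is at least its square, it suffices to bound \<open>\<Sum> |u\<^sub>i| |u\<^sub>j| cos\<^sup>2\<close>; as
  \<open>cos\<^sup>2 \<alpha> = (1 + cos 2\<alpha>) / 2\<close>, that sum is half of \<open>(\<Sum> |u\<^sub>i|)\<^sup>2 + |\<Sum> s\<^sub>i|\<^sup>2\<close>, where \<open>s\<^sub>i\<close> is \<open>u\<^sub>i\<close>
  with its argument doubled.\<close>
lemma sum_pairwise_acute:
  fixes u :: "'a \<Rightarrow> complex"
  assumes nz: "\<And>i. i \<in> R \<Longrightarrow> u i \<noteq> 0"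
    and acute: "\<And>i j. i \<in> R \<Longrightarrow> j \<in> R \<Longrightarrow> 0 \<le> Re (u i * cnj (u j))"
  shows "(\<Sum>i\<in>R. cmod (u i))\<^sup>2 / 2 \<le> (\<Sum>i\<in>R. \<Sum>j\<in>R. Re (u i * cnj (u j)))"
proof -
  define s where "s = (\<lambda>i. (u i)\<^sup>2 / of_real (cmod (u i)))"
  have pt: "(cmod (u i) * cmod (u j) + Re (s i * cnj (s j))) / 2 \<le> Re (u i * cnj (u j))"
    if i: "i \<in> R" and j: "j \<in> R" for i j
  proof -
    define p where "p = cmod (u i) * cmod (u j)"
    define z where "z = u i * cnj (u j)"
    have p: "p > 0" using nz[OF i] nz[OF j] by (simp add: p_def)
    have pz: "p = cmod z" by (simp add: p_def z_def norm_mult)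
    have c: "0 \<le> Re z" "Re z \<le> p"
      using acute[OF i j] complex_Re_le_cmod[of z] by (auto simp: z_def pz)
    have "s i * cnj (s j) = z\<^sup>2 / of_real p"
      by (simp add: s_def z_def p_def power_mult_distrib)
    then have "Re (s i * cnj (s j)) = Re (z\<^sup>2) / p"
      by simp
    also have "Re (z\<^sup>2) = 2 * (Re z)\<^sup>2 - p\<^sup>2"
      unfolding pz cmod_power2 by (simp add: Re_power2)
    finally have "(p + Re (s i * cnj (s j))) / 2 = (Re z)\<^sup>2 / p"
      using p by (simp add: field_simps power2_eq_square)
    also have "\<dots> \<le> Re z"
      using p c by (simp add: divide_le_eq power2_eq_square mult_left_mono)
    finally show ?thesis by (simp add: p_def z_def)
  qed
  have "(\<Sum>i\<in>R. \<Sum>j\<in>R. Re (s i * cnj (s j))) = Re ((\<Sum>i\<in>R. s i) * cnj (\<Sum>i\<in>R. s i))"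
    by (simp add: sum_product)
  also have "\<dots> \<ge> 0"
    unfolding complex_norm_square[symmetric] by simp
  finally have "(\<Sum>i\<in>R. \<Sum>j\<in>R. Re (s i * cnj (s j))) \<ge> 0" .
  then have "(\<Sum>i\<in>R. cmod (u i))\<^sup>2 / 2
      \<le> (\<Sum>i\<in>R. \<Sum>j\<in>R. (cmod (u i) * cmod (u j) + Re (s i * cnj (s j))) / 2)"
    by (simp add: power2_eq_square sum_product sum.distrib flip: sum_divide_distrib)
  also have "\<dots> \<le> (\<Sum>i\<in>R. \<Sum>j\<in>R. Re (u i * cnj (u j)))"
    by (intro sum_mono pt)
  finally show ?thesis .
qed

text \<open>Two combinations of such vectors, with coefficients for which all \<open>a\<^sub>i cnj b\<^sub>j\<close> are nearly
  positive reals, again enclose an acute angle. Expanding the product, the part with \<open>Re (a\<^sub>i cnj b\<^sub>j)\<close> is at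
  least \<open>\<kappa> T\<^sup>2 / 2\<close> for \<open>T = \<Sum> |u\<^sub>i|\<close> by \<open>sum_pairwise_acute\<close>, and the part with
  \<open>Im (a\<^sub>i cnj b\<^sub>j)\<close> is at most \<open>\<kappa> T\<^sup>2 / 3\<close>.\<close>
lemma acute_combination:
  fixes u a b :: "'a \<Rightarrow> complex"
  assumes fin: "finite R" and ne: "R \<noteq> {}" and nz: "\<And>i. i \<in> R \<Longrightarrow> u i \<noteq> 0"
    and acute: "\<And>i j. i \<in> R \<Longrightarrow> j \<in> R \<Longrightarrow> 0 \<le> Re (u i * cnj (u j))"
    and \<kappa>: "0 < \<kappa>"
    and re: "\<And>i j. i \<in> R \<Longrightarrow> j \<in> R \<Longrightarrow> \<kappa> \<le> Re (a i * cnj (b j))"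
    and im: "\<And>i j. i \<in> R \<Longrightarrow> j \<in> R \<Longrightarrow> \<bar>Im (a i * cnj (b j))\<bar> \<le> \<kappa> / 3"
  shows "0 < Re ((\<Sum>i\<in>R. a i * u i) * cnj (\<Sum>i\<in>R. b i * u i))"
proof -
  define T where "T = (\<Sum>i\<in>R. cmod (u i))"
  have T: "T > 0"
    unfolding T_def using fin ne nz by (intro sum_pos) auto
  have "\<kappa> * (\<Sum>i\<in>R. \<Sum>j\<in>R. Re (u i * cnj (u j))) - \<kappa> / 3 * T\<^sup>2
      = (\<Sum>i\<in>R. \<Sum>j\<in>R. \<kappa> * Re (u i * cnj (u j)) - \<kappa> / 3 * (cmod (u i) * cmod (u j)))"
  proof -
    have "T\<^sup>2 = (\<Sum>i\<in>R. \<Sum>j\<in>R. cmod (u i) * cmod (u j))"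
      by (simp add: T_def power2_eq_square sum_product)
    then show ?thesis by (simp only: sum_subtractf sum_distrib_left)
  qed
  also have "\<dots> \<le> (\<Sum>i\<in>R. \<Sum>j\<in>R. Re ((a i * u i) * cnj (b j * u j)))"
  proof (intro sum_mono)
    fix i j assume i: "i \<in> R" and j: "j \<in> R"
    define c z where "c = a i * cnj (b j)" and "z = u i * cnj (u j)"
    have "\<kappa> * Re z \<le> Re c * Re z"
      using re[OF i j] acute[OF i j] by (intro mult_right_mono) (auto simp: c_def z_def)
    moreover have "Im c * Im z \<le> \<kappa> / 3 * cmod z"
    proof -
      have "Im c * Im z \<le> \<bar>Im c\<bar> * \<bar>Im z\<bar>" by (simp flip: abs_mult)
      also have "\<dots> \<le> \<kappa> / 3 * cmod z"
        using im[OF i j] \<kappa> by (intro mult_mono abs_Im_le_cmod) (auto simp: c_def)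
      finally show ?thesis .
    qed
    moreover have "Re ((a i * u i) * cnj (b j * u j)) = Re c * Re z - Im c * Im z"
    proof -
      have "(a i * u i) * cnj (b j * u j) = c * z" by (simp add: c_def z_def)
      then show ?thesis by (simp only: times_complex.sel)
    qed
    moreover have "cmod z = cmod (u i) * cmod (u j)" by (simp add: z_def norm_mult)
    ultimately show "\<kappa> * Re (u i * cnj (u j)) - \<kappa> / 3 * (cmod (u i) * cmod (u j))
        \<le> Re ((a i * u i) * cnj (b j * u j))"
      by (simp only: z_def [symmetric])
  qed
  also have "\<dots> = Re ((\<Sum>i\<in>R. a i * u i) * cnj (\<Sum>i\<in>R. b i * u i))"
    by (simp add: sum_product)
  finally have "\<kappa> * (\<Sum>i\<in>R. \<Sum>j\<in>R. Re (u i * cnj (u j))) - \<kappa> / 3 * T\<^sup>2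
      \<le> Re ((\<Sum>i\<in>R. a i * u i) * cnj (\<Sum>i\<in>R. b i * u i))" .
  moreover have "\<kappa> * (T\<^sup>2 / 2) \<le> \<kappa> * (\<Sum>i\<in>R. \<Sum>j\<in>R. Re (u i * cnj (u j)))"
    using sum_pairwise_acute[OF nz acute] \<kappa> by (intro mult_left_mono) (auto simp: T_def)
  moreover have "\<kappa> * T\<^sup>2 > 0" using \<kappa> T by simp
  ultimately show ?thesis by linarith
qed

text \<open>The matching sums obtained by removing one vertex from an odd set \<open>R\<close> pairwise enclose acute
  angles. For \<open>y \<noteq> y'\<close>, expand the sum over \<open>R - {y}\<close> along \<open>y'\<close> and the sum over \<open>R - {y'}\<close> along
  \<open>y\<close>: both are combinations of the same matching sums, those over \<open>R - {y, y'}\<close> with one further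
  vertex removed. By induction these pairwise enclose acute angles, so \<open>acute_combination\<close>
  applies. For \<open>y = y'\<close>, where the claim is nonvanishing, expand both factors along the same further vertex.\<close>
lemma matching_sums_acute:
  fixes w :: "'a set \<Rightarrow> complex"
  assumes \<kappa>: "0 < \<kappa>"
    and re: "\<And>c d. c \<in> K \<Longrightarrow> d \<in> K \<Longrightarrow> \<kappa> \<le> Re (c * cnj d)"
    and im: "\<And>c d. c \<in> K \<Longrightarrow> d \<in> K \<Longrightarrow> \<bar>Im (c * cnj d)\<bar> \<le> \<kappa> / 3"
    and "finite R" "card R = Suc (2 * m)" "y \<in> R" "y' \<in> R"
    and "\<And>i j. i \<in> R \<Longrightarrow> j \<in> R \<Longrightarrow> i \<noteq> j \<Longrightarrow> w {i, j} \<in> K"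
  shows "0 < Re (matching_sum w (R - {y}) * cnj (matching_sum w (R - {y'})))"
  using assms(4-8)
proof (induction m arbitrary: R y y')
  case 0
  then have "R = {y}" "R = {y'}" by (auto simp: card_1_singleton_iff)
  then show ?case by simp
next
  case (Suc m)
  \<comment> \<open>Here \<open>r\<close> and \<open>t\<close> are the vertices along which the two sums are expanded; \<open>{p, r} = {q, t}\<close> says
    that both expansions lead to the same set \<open>Q\<close>.\<close>
  have step: "0 < Re (matching_sum w (R - {p}) * cnj (matching_sum w (R - {q})))"
    if "p \<in> R" "q \<in> R" "r \<in> R" "t \<in> R" "p \<noteq> r" "q \<noteq> t" "{p, r} = {q, t}" for p q r t
  proof -
    define Q where "Q = R - {p, r}"
    have Q: "finite Q" "card Q = Suc (2 * m)"
      using Suc.prems(1,2) that by (auto simp: Q_def card_Diff_subset)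
    then have ne: "Q \<noteq> {}" by auto
    have acute: "0 < Re (matching_sum w (Q - {i}) * cnj (matching_sum w (Q - {j})))"
      if "i \<in> Q" "j \<in> Q" for i j
      using that by (intro Suc.IH[OF Q] Suc.prems(5)) (auto simp: Q_def)
    have nonzero: "matching_sum w (Q - {i}) \<noteq> 0" if "i \<in> Q" for i
      using acute[OF that that] by auto
    have wK: "w {r, i} \<in> K" "w {t, i} \<in> K" if "i \<in> Q" for i
      using that \<open>r \<in> R\<close> \<open>t \<in> R\<close> \<open>{p, r} = {q, t}\<close> by (auto simp: Q_def intro!: Suc.prems(5))
    have eqs: "R - {p} - {r} = Q" "R - {q} - {t} = Q"
      using that(7) by (auto simp: Q_def)
    have eq: "\<And>z. R - {p} - {r, z} = Q - {z}" "\<And>z. R - {q} - {t, z} = Q - {z}"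
      using eqs by auto
    have 1: "matching_sum w (R - {p}) = (\<Sum>z\<in>Q. w {r, z} * matching_sum w (Q - {z}))"
      using matching_sum_expand[of "R - {p}" r w] Suc.prems(1) that by (simp add: eqs eq)
    have 2: "matching_sum w (R - {q}) = (\<Sum>z\<in>Q. w {t, z} * matching_sum w (Q - {z}))"
      using matching_sum_expand[of "R - {q}" t w] Suc.prems(1) that by (simp add: eqs eq)
    show ?thesis unfolding 1 2
      by (rule acute_combination[OF Q(1) ne nonzero less_imp_le[OF acute] \<kappa>
            re[OF wK(1) wK(2)] im[OF wK(1) wK(2)]])
  qed
  show ?case
  proof (cases "y = y'")
    case True
    have "R \<noteq> {y}" using Suc.prems(2) by auto
    then obtain r where "r \<in> R" "r \<noteq> y" using Suc.prems(3) by blast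
    then show ?thesis using step[of y y r r] Suc.prems(3) True by auto
  next
    case False
    then show ?thesis using step[of y y' y' y] Suc.prems(3,4) by auto
  qed
qed

text \<open>One more expansion, combined with itself, turns the acute angles into nonvanishing.\<close>
lemma matching_sum_nonzero:
  fixes w :: "'a set \<Rightarrow> complex"
  assumes \<kappa>: "0 < \<kappa>"
    and re: "\<And>c d. c \<in> K \<Longrightarrow> d \<in> K \<Longrightarrow> \<kappa> \<le> Re (c * cnj d)"
    and im: "\<And>c d. c \<in> K \<Longrightarrow> d \<in> K \<Longrightarrow> \<bar>Im (c * cnj d)\<bar> \<le> \<kappa> / 3"
    and S: "finite S" "card S = 2 * m"
    and w: "\<And>i j. i \<in> S \<Longrightarrow> j \<in> S \<Longrightarrow> i \<noteq> j \<Longrightarrow> w {i, j} \<in> K"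
  shows "matching_sum w S \<noteq> 0"
proof (cases m)
  case 0
  then show ?thesis using S by simp
next
  case (Suc k)
  with S have "S \<noteq> {}" by auto
  then obtain x where x: "x \<in> S" by blast
  define Q where "Q = S - {x}"
  have Q: "finite Q" "card Q = Suc (2 * k)" using S x Suc by (auto simp: Q_def)
  have acute: "0 < Re (matching_sum w (Q - {i}) * cnj (matching_sum w (Q - {j})))"
    if "i \<in> Q" "j \<in> Q" for i j
    by (rule matching_sums_acute[OF \<kappa> re im Q that]) (auto simp: Q_def intro: w)
  have wK: "w {x, i} \<in> K" if "i \<in> Q" for i
    using that x by (auto simp: Q_def intro!: w)
  have "S - {x, z} = Q - {z}" for z
    by (auto simp: Q_def)
  with matching_sum_expand[OF S(1) x, of w]
  have eq: "matching_sum w S = (\<Sum>z\<in>Q. w {x, z} * matching_sum w (Q - {z}))"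
    by (simp flip: Q_def)
  have "0 < Re (matching_sum w S * cnj (matching_sum w S))"
    unfolding eq
  proof (rule acute_combination[OF Q(1) _ _ less_imp_le[OF acute] \<kappa> re[OF wK wK] im[OF wK wK]])
    show "Q \<noteq> {}" using Q(2) by auto
    fix z assume "z \<in> Q"
    from acute[OF this this] show "matching_sum w (Q - {z}) \<noteq> 0" by auto
  qed
  then show ?thesis by auto
qed

section \<open>Polynomial functions with real coefficients\<close>
definition monom_eval :: "('v \<Rightarrow> 'a :: comm_semiring_1) \<Rightarrow> ('v \<Rightarrow>\<^sub>0 nat) \<Rightarrow> 'a" where
  "monom_eval x m = (\<Prod>v\<in>Poly_Mapping.keys m. x v ^ Poly_Mapping.lookup m v)"

definition monom_degree :: "('v \<Rightarrow>\<^sub>0 nat) \<Rightarrow> nat" where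
  "monom_degree m = (\<Sum>v\<in>Poly_Mapping.keys m. Poly_Mapping.lookup m v)"

lemma mpoly_degree_le_iff:
  "mpoly_degree p \<le> d \<longleftrightarrow> (\<forall>m\<in>Poly_Mapping.keys p. monom_degree m \<le> d)"
  by (auto simp: mpoly_degree_def monom_degree_def)

lemma mpoly_eval_superset:
  assumes "finite M" "Poly_Mapping.keys p \<subseteq> M"
  shows "mpoly_eval x p = (\<Sum>m\<in>M. Poly_Mapping.lookup p m * monom_eval x m)"
  unfolding mpoly_eval_def monom_eval_def
  using assms by (intro sum.mono_neutral_left) (auto simp: in_keys_iff)

lemma mpoly_eval_add: "mpoly_eval x (p + q) = mpoly_eval x p + mpoly_eval x q"
proof -
  let ?M = "Poly_Mapping.keys p \<union> Poly_Mapping.keys q"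
  have "Poly_Mapping.keys (p + q) \<subseteq> ?M" by (rule keys_add)
  then show ?thesis
    by (simp add: mpoly_eval_superset[of ?M] lookup_add distrib_right sum.distrib)
qed

lemma keys_add_nat:
  "Poly_Mapping.keys (m + m') = Poly_Mapping.keys m \<union> Poly_Mapping.keys m'"
  for m m' :: "'v \<Rightarrow>\<^sub>0 nat"
  by (auto simp: in_keys_iff lookup_add)

lemma monom_eval_superset:
  assumes "finite V" "Poly_Mapping.keys m \<subseteq> V"
  shows "monom_eval x m = (\<Prod>v\<in>V. x v ^ Poly_Mapping.lookup m v)"
  unfolding monom_eval_def
  using assms by (intro prod.mono_neutral_left) (auto simp: in_keys_iff)

lemma monom_eval_add: "monom_eval x (m + m') = monom_eval x m * monom_eval x m'"
  by (simp add: monom_eval_superset[of "Poly_Mapping.keys m \<union> Poly_Mapping.keys m'"]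
      keys_add_nat lookup_add power_add prod.distrib)

lemma monom_degree_superset:
  assumes "finite V" "Poly_Mapping.keys m \<subseteq> V"
  shows "monom_degree m = (\<Sum>v\<in>V. Poly_Mapping.lookup m v)"
  unfolding monom_degree_def
  using assms by (intro sum.mono_neutral_left) (auto simp: in_keys_iff)

lemma monom_degree_add: "monom_degree (m + m') = monom_degree m + monom_degree m'"
  by (simp add: monom_degree_superset[of "Poly_Mapping.keys m \<union> Poly_Mapping.keys m'"]
      keys_add_nat lookup_add sum.distrib)

text \<open>The values lie in \<open>\<complex>\<close>, although they are real, because such functions will be the coefficients of
  complex power series.\<close>
definition real_poly_fun :: "'v set \<Rightarrow> nat \<Rightarrow> (('v \<Rightarrow> real) \<Rightarrow> complex) \<Rightarrow> bool" where
  "real_poly_fun V d F \<longleftrightarrow> (\<exists>p :: ('v, real) mpoly. mpoly_vars p \<subseteq> V \<and> mpoly_degree p \<le> d \<and>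
     (\<forall>x. F x = complex_of_real (mpoly_eval x p)))"

lemma real_poly_fun_add:
  assumes "real_poly_fun V d F" "real_poly_fun V d G"
  shows "real_poly_fun V d (\<lambda>x. F x + G x)"
proof -
  from assms obtain p q :: "('a, real) mpoly" where
    p: "mpoly_vars p \<subseteq> V" "mpoly_degree p \<le> d" "\<And>x. F x = complex_of_real (mpoly_eval x p)" and
    q: "mpoly_vars q \<subseteq> V" "mpoly_degree q \<le> d" "\<And>x. G x = complex_of_real (mpoly_eval x q)"
    unfolding real_poly_fun_def by auto
  show ?thesis
    unfolding real_poly_fun_def
  proof (intro exI[of _ "p + q"] conjI allI)
    show "mpoly_vars (p + q) \<subseteq> V" "mpoly_degree (p + q) \<le> d"
      using p(1,2) q(1,2) keys_add[of p q]
      unfolding mpoly_degree_le_iff mpoly_vars_def by blast+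
  qed (simp add: p(3) q(3) mpoly_eval_add)
qed

lemma real_poly_fun_monomial:
  assumes "Poly_Mapping.keys m \<subseteq> V" "monom_degree m \<le> d"
  shows "real_poly_fun V d (\<lambda>x. of_real (c * monom_eval x m))"
  unfolding real_poly_fun_def
proof (intro exI[of _ "Poly_Mapping.single m c"] conjI allI)
  show "mpoly_vars (Poly_Mapping.single m c) \<subseteq> V"
    "mpoly_degree (Poly_Mapping.single m c) \<le> d"
    using assms by (auto simp: mpoly_vars_def mpoly_degree_le_iff)
qed (simp add: mpoly_eval_superset[of "{m}"])

lemma real_poly_fun_const: "real_poly_fun V d (\<lambda>x. of_real c)"
  using real_poly_fun_monomial[of 0 V d c] by (simp add: monom_degree_def monom_eval_def)

lemma real_poly_fun_var:
  assumes "v \<in> V" "1 \<le> d"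
  shows "real_poly_fun V d (\<lambda>x. of_real (x v))"
  using real_poly_fun_monomial[of "Poly_Mapping.single v 1" V d 1] assms
  by (simp add: monom_degree_def monom_eval_def)

lemma real_poly_fun_sum:
  assumes "\<And>i. i \<in> I \<Longrightarrow> real_poly_fun V d (F i)"
  shows "real_poly_fun V d (\<lambda>x. \<Sum>i\<in>I. F i x)"
  using assms
proof (induction I rule: infinite_finite_induct)
  case (insert i I)
  then show ?case by (simp add: real_poly_fun_add)
qed (use real_poly_fun_const[of V d 0] in simp_all)

lemma real_poly_fun_mult:
  assumes "real_poly_fun V a F" "real_poly_fun V b G" "a + b \<le> d"
  shows "real_poly_fun V d (\<lambda>x. F x * G x)"
proof -
  from assms obtain p q :: "('a, real) mpoly" where
    p: "mpoly_vars p \<subseteq> V" "mpoly_degree p \<le> a" "\<And>x. F x = complex_of_real (mpoly_eval x p)" and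
    q: "mpoly_vars q \<subseteq> V" "mpoly_degree q \<le> b" "\<And>x. G x = complex_of_real (mpoly_eval x q)"
    unfolding real_poly_fun_def by auto
  have "F x * G x = (\<Sum>m\<in>Poly_Mapping.keys p. \<Sum>m'\<in>Poly_Mapping.keys q.
      of_real (Poly_Mapping.lookup p m * Poly_Mapping.lookup q m' * monom_eval x (m + m')))" for x
    by (simp add: p(3) q(3) mpoly_eval_superset[OF _ order_refl] sum_product monom_eval_add ac_simps)
  moreover have "real_poly_fun V d (\<lambda>x. \<Sum>m\<in>Poly_Mapping.keys p. \<Sum>m'\<in>Poly_Mapping.keys q.
      of_real (Poly_Mapping.lookup p m * Poly_Mapping.lookup q m' * monom_eval x (m + m')))"
  proof (intro real_poly_fun_sum real_poly_fun_monomial)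
    fix m m' assume m: "m \<in> Poly_Mapping.keys p" "m' \<in> Poly_Mapping.keys q"
    show "Poly_Mapping.keys (m + m') \<subseteq> V"
      using m p(1) q(1) by (auto simp: keys_add_nat mpoly_vars_def)
    have "monom_degree m \<le> a" "monom_degree m' \<le> b"
      using m p(2) q(2) by (auto simp: mpoly_degree_le_iff)
    then show "monom_degree (m + m') \<le> d"
      using assms(3) by (simp add: monom_degree_add)
  qed
  ultimately show ?thesis by simp
qed

lemma real_poly_fun_mono: "real_poly_fun V a F \<Longrightarrow> a \<le> d \<Longrightarrow> real_poly_fun V d F"
  unfolding real_poly_fun_def by (meson order_trans)

section \<open>Power series whose coefficients are polynomials of bounded degree\<close>

text \<open>If every entry of the matrix carries one factor of the series variable, the coefficient of
  degree \<open>k\<close> has degree at most \<open>k\<close> in the entries. This property survives sums, products and the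
  logarithm, so it bounds the degree of a truncated series by the truncation order.\<close>
definition graded :: "'v set \<Rightarrow> (('v \<Rightarrow> real) \<Rightarrow> complex fps) \<Rightarrow> bool" where
  "graded V \<Phi> \<longleftrightarrow> (\<forall>k. real_poly_fun V k (\<lambda>x. fps_nth (\<Phi> x) k))"

lemma graded_const:
  assumes "\<And>k. fps_nth F k \<in> \<real>"
  shows "graded V (\<lambda>_. F)"
proof -
  have "fps_nth F k = of_real (Re (fps_nth F k))" for k
    using assms by (simp add: complex_is_Real_iff complex_eq_iff)
  then show ?thesis unfolding graded_def by (metis real_poly_fun_const)
qed

lemma graded_1: "graded V (\<lambda>_. 1)"
  by (rule graded_const) (simp add: fps_one_nth)

lemma graded_add: "graded V F \<Longrightarrow> graded V G \<Longrightarrow> graded V (\<lambda>x. F x + G x)"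
  by (simp add: graded_def real_poly_fun_add)

lemma graded_sum: "(\<And>i. i \<in> I \<Longrightarrow> graded V (F i)) \<Longrightarrow> graded V (\<lambda>x. \<Sum>i\<in>I. F i x)"
  by (simp add: graded_def fps_sum_nth real_poly_fun_sum)

lemma graded_mult:
  assumes "graded V F" "graded V G"
  shows "graded V (\<lambda>x. F x * G x)"
  unfolding graded_def fps_mult_nth
proof (intro allI real_poly_fun_sum)
  fix k i :: nat assume "i \<in> {0..k}"
  then show "real_poly_fun V k (\<lambda>x. fps_nth (F x) i * fps_nth (G x) (k - i))"
    using assms by (intro real_poly_fun_mult[of V i _ "k - i"]) (auto simp: graded_def)
qed

lemma graded_prod: "(\<And>i. i \<in> I \<Longrightarrow> graded V (F i)) \<Longrightarrow> graded V (\<lambda>x. \<Prod>i\<in>I. F i x)"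
  by (induction I rule: infinite_finite_induct) (simp_all add: graded_1 graded_mult)

text \<open>Without constant term, the series \<open>F\<close> has its first nonzero coefficient in degree at least \<open>1\<close>,
  which pays for the linear factor.\<close>
lemma graded_const_mult_linear:
  assumes "\<And>k. fps_nth F k \<in> \<real>" "fps_nth F 0 = 0" "v \<in> V"
  shows "graded V (\<lambda>x. F * fps_const (of_real (x v) - 1))"
  unfolding graded_def
proof (intro allI)
  fix k :: nat
  define c where "c = Re (fps_nth F k)"
  have c: "fps_nth F k = of_real c"
    using assms(1) by (simp add: complex_is_Real_iff complex_eq_iff c_def)
  show "real_poly_fun V k (\<lambda>x. fps_nth (F * fps_const (of_real (x v) - 1)) k)"
  proof (cases "k = 0")
    case True
    then show ?thesis using assms(2) real_poly_fun_const[of V 0 0] by simp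
  next
    case False
    have "real_poly_fun V k (\<lambda>x. of_real c * (of_real (x v) + of_real (- 1)))"
      using False assms(3)
      by (intro real_poly_fun_mult[of V 0 _ k] real_poly_fun_add real_poly_fun_var
          real_poly_fun_const) auto
    then show ?thesis by (simp add: c)
  qed
qed

text \<open>The logarithm of a series with constant term \<open>1\<close>, as the antiderivative of the logarithmic
  derivative. Being formal, it is available for all values of the variables, also where the
  corresponding function has zeros.\<close>
definition fps_log :: "complex fps \<Rightarrow> complex fps" where
  "fps_log H = fps_integral0 (fps_deriv H * inverse H)"

lemma fps_deriv_fps_log:
  assumes "fps_nth H 0 \<noteq> 0"
  shows "fps_deriv (fps_log H) * H = fps_deriv H"
proof -
  have "fps_deriv (fps_log H) = fps_deriv H * inverse H"
    by (simp add: fps_log_def fps_deriv_fps_integral)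
  then show ?thesis using assms by (simp add: mult.assoc inverse_mult_eq_1)
qed

lemma fps_log_nth_0: "fps_nth (fps_log H) 0 = 0"
  by (simp add: fps_log_def fps_integral_def)

lemma fps_log_unique:
  assumes "fps_nth H 0 \<noteq> 0" "fps_nth F 0 = 0" "fps_deriv F * H = fps_deriv H"
  shows "F = fps_log H"
proof -
  have "fps_deriv F * H = fps_deriv (fps_log H) * H"
    using assms fps_deriv_fps_log by simp
  moreover have "H \<noteq> 0" using assms(1) by auto
  ultimately have "fps_deriv F = fps_deriv (fps_log H)" by simp
  then show ?thesis
    using assms(2) by (simp add: fps_deriv_eq_iff fps_log_nth_0)
qed

text \<open>Comparing coefficients in \<open>G' H = H'\<close> for \<open>G = log H\<close> expresses each coefficient of \<open>G\<close> by
  earlier ones.\<close>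
lemma fps_log_recursion:
  assumes "fps_nth H 0 = 1"
  shows "fps_nth (fps_log H) (Suc k) = fps_nth H (Suc k) +
    of_real (- 1 / real (Suc k)) *
      (\<Sum>i<k. of_real (real (Suc i)) * (fps_nth (fps_log H) (Suc i) * fps_nth H (k - i)))"
proof -
  let ?G = "fps_log H"
  let ?S = "\<Sum>i<k. of_real (real (Suc i)) * (fps_nth ?G (Suc i) * fps_nth H (k - i))"
  have "of_nat (Suc k) * fps_nth H (Suc k) = fps_nth (fps_deriv ?G * H) k"
    using assms by (simp add: fps_deriv_fps_log)
  also have "\<dots> = ?S + of_nat (Suc k) * fps_nth ?G (Suc k)"
    using assms by (simp add: fps_mult_nth atLeast0AtMost mult.assoc flip: lessThan_Suc_atMost)
  finally have eq: "of_nat (Suc k) * fps_nth H (Suc k) = ?S + of_nat (Suc k) * fps_nth ?G (Suc k)" .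
  have "complex_of_nat (Suc k) \<noteq> 0" by (simp del: of_nat_Suc)
  with eq show ?thesis
    by (simp add: field_simps del: of_nat_Suc)
qed

text \<open>In the recursion, every product combines indices \<open>i + 1\<close> and \<open>l - i\<close>, whose sum is the index
  \<open>l + 1\<close> of the coefficient on the left.\<close>
lemma graded_fps_log:
  assumes H: "graded V H" and H0: "\<And>x. fps_nth (H x) 0 = 1"
  shows "graded V (\<lambda>x. fps_log (H x))"
  unfolding graded_def
proof
  fix k show "real_poly_fun V k (\<lambda>x. fps_nth (fps_log (H x)) k)"
  proof (induction k rule: less_induct)
    case (less k)
    show ?case
    proof (cases k)
      case 0
      then show ?thesis using real_poly_fun_const[of V 0 0] by (simp add: fps_log_nth_0)
    next
      case (Suc l)
      have "real_poly_fun V (Suc l) (\<lambda>x. fps_nth (H x) (Suc l) + of_real (- 1 / real (Suc l)) *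
        (\<Sum>i<l. of_real (real (Suc i)) * (fps_nth (fps_log (H x)) (Suc i) * fps_nth (H x) (l - i))))"
      proof (intro real_poly_fun_add real_poly_fun_mult[OF real_poly_fun_const[of V 0], where b = "Suc l"]
          real_poly_fun_sum)
        show "real_poly_fun V (Suc l) (\<lambda>x. fps_nth (H x) (Suc l))"
          using H by (simp add: graded_def)
        fix i assume "i \<in> {..<l}"
        then show "real_poly_fun V (Suc l) (\<lambda>x. fps_nth (fps_log (H x)) (Suc i) * fps_nth (H x) (l - i))"
          using H Suc by (intro real_poly_fun_mult[of V "Suc i" _ "l - i"] less) (auto simp: graded_def)
      qed auto
      then show ?thesis by (simp only: Suc fps_log_recursion[OF H0, where k = l])
    qed
  qed
qed

section \<open>Taylor coefficients of functions with bounded real part\<close>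

text \<open>The Moebius map \<open>v \<mapsto> v / (2 M - v)\<close> takes the half-plane \<open>Re v < M\<close> into the unit disk and fixes
  \<open>0\<close>, so the Schwarz lemma bounds its composition with \<open>G\<close>. Solving for \<open>G\<close> gives the bound.\<close>
lemma Borel_Caratheodory:
  assumes hol: "G holomorphic_on ball 0 R" and G0: "G 0 = 0"
    and re: "\<And>z. norm z < R \<Longrightarrow> Re (G z) < M" and z: "norm z < R"
  shows "norm (G z) \<le> 2 * M * norm z / (R - norm z)"
proof -
  have R: "R > 0" using z norm_ge_zero[of z] by linarith
  have M: "M > 0" using re[of 0] R G0 by simp
  define q where "q = (\<lambda>w. G (of_real R * w) / (of_real (2 * M) - G (of_real R * w)))"
  have arg: "norm (of_real R * w) < R" if "norm w < 1" for w :: complex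
    using that R by (simp add: norm_mult)
  have less: "norm v < norm (of_real (2 * M) - v)" if "Re v < M" for v
  proof -
    have "(2 * M - Re v)\<^sup>2 - (Re v)\<^sup>2 = 4 * M * (M - Re v)"
      by (simp add: power2_eq_square algebra_simps)
    moreover have "4 * M * (M - Re v) > 0" using M that by simp
    ultimately have "(norm v)\<^sup>2 < (norm (of_real (2 * M) - v))\<^sup>2"
      by (simp add: cmod_power2)
    then show ?thesis by (rule power_less_imp_less_base) simp
  qed
  have den: "of_real (2 * M) - G (of_real R * w) \<noteq> 0" if "norm w < 1" for w
    using less[OF re[OF arg[OF that]]] by auto
  have "q holomorphic_on ball 0 1"
    unfolding q_def
    by (intro holomorphic_intros holomorphic_on_compose_gen[OF _ hol, unfolded o_def])
       (use arg den in auto)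
  moreover have "q 0 = 0" by (simp add: q_def G0)
  moreover have "norm (q w) < 1" if "norm w < 1" for w
    using less[OF re[OF arg[OF that]]] by (simp add: q_def norm_divide divide_less_eq)
  moreover define w where "w = z / of_real R"
  moreover have w1: "norm w < 1" using z R by (simp add: w_def norm_divide)
  ultimately have qw: "norm (q w) \<le> norm w"
    using Schwarz_Lemma(1) by blast
  have Rw: "of_real R * w = z" using R by (simp add: w_def)
  have "G z = q w * (of_real (2 * M) - G z)"
    using den[OF w1] by (simp add: q_def Rw)
  then have "norm (G z) = norm (q w) * norm (of_real (2 * M) - G z)"
    by (metis norm_mult)
  also have "\<dots> \<le> norm w * (2 * M + norm (G z))"
    using qw M norm_triangle_ineq4[of "of_real (2 * M)" "G z"]
    by (intro mult_mono) auto
  finally have "norm (G z) * R \<le> norm z * (2 * M + norm (G z))"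
    using R by (simp add: w_def norm_divide field_simps)
  then show ?thesis using z by (simp add: field_simps)
qed

text \<open>Cauchy's inequality on the circle of radius \<open>r\<close>, where \<open>Borel_Caratheodory\<close> bounds \<open>|G|\<close>.\<close>
lemma coeff_bound_of_Re_bound:
  assumes hol: "G holomorphic_on ball 0 R" and G0: "G 0 = 0"
    and re: "\<And>z. norm z < R \<Longrightarrow> Re (G z) < M"
    and r: "0 < r" "r < R" and F: "G has_fps_expansion F"
  shows "norm (fps_nth F k) \<le> 2 * M * r / (R - r) / r ^ k"
proof -
  have "norm ((deriv ^^ k) G 0) \<le> fact k * (2 * M * r / (R - r)) / r ^ k"
  proof (rule Cauchy_inequality[OF _ _ r(1)])
    show "G holomorphic_on ball 0 r"
      using hol r by (auto intro: holomorphic_on_subset)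
    show "continuous_on (cball 0 r) G"
      using r by (auto intro!: holomorphic_on_imp_continuous_on holomorphic_on_subset[OF hol])
    show "norm (G z) \<le> 2 * M * r / (R - r)" if "norm (0 - z) = r" for z
      using Borel_Caratheodory[OF hol G0 re, of z] that r by simp
  qed
  then show ?thesis
    by (simp add: fps_nth_fps_expansion[OF F] norm_divide field_simps)
qed

lemma power_series_tail:
  fixes g :: "nat \<Rightarrow> complex"
  assumes g: "g sums S" and bound: "\<And>k. norm (g k) \<le> C / r ^ k" and r: "1 < r"
  shows "norm (S - (\<Sum>k\<le>d. g k)) \<le> C / (r ^ d * (r - 1))"
proof -
  have "norm (S - (\<Sum>k\<le>d. g k)) \<le> C / r ^ Suc d * (1 / (1 - 1 / r))"
  proof (rule norm_sums_le)
    show "(\<lambda>k. g (k + Suc d)) sums (S - (\<Sum>k\<le>d. g k))"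
      using sums_split_initial_segment[OF g, of "Suc d"] by (simp add: lessThan_Suc_atMost)
    show "(\<lambda>k. C / r ^ Suc d * (1 / r) ^ k) sums (C / r ^ Suc d * (1 / (1 - 1 / r)))"
      using r by (intro sums_mult geometric_sums) simp
    have "C / r ^ Suc d * (1 / r) ^ k = C / r ^ (k + Suc d)" for k
      by (simp only: power_one_over times_divide_times_eq mult_1_right power_add mult.commute)
    then show "norm (g (k + Suc d)) \<le> C / r ^ Suc d * (1 / r) ^ k" for k
      using bound[of "k + Suc d"] by simp
  qed
  also have "\<dots> = C / (r ^ d * (r - 1))"
    using r by (simp add: field_simps)
  finally show ?thesis .
qed

section \<open>A map from a disk into a thin strip\<close>

text \<open>The map \<open>z \<mapsto> - ln (1 - \<alpha> z) / L\<close> with \<open>\<alpha> = 1 - exp (- L)\<close> sends \<open>0\<close> to \<open>0\<close> and \<open>1\<close> to \<open>1\<close>. The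
  logarithm turns the right half-plane into a strip of fixed width \<open>\<pi>\<close>, so for large \<open>L\<close> the image of
  the disk lies close to the segment \<open>[0, 1]\<close>. The radius \<open>\<beta> > 1\<close> of the disk is the solution of
  \<open>1 - \<alpha> \<beta> = exp (- (L + 1))\<close>, which lets the real part exceed \<open>1\<close> by only \<open>1 / L\<close>.\<close>
definition strip_scale :: "real \<Rightarrow> real" where "strip_scale L = 1 - exp (- L)"

definition strip_radius :: "real \<Rightarrow> real" where
  "strip_radius L = (1 - exp (- (L + 1))) / (1 - exp (- L))"

definition strip_map :: "real \<Rightarrow> complex \<Rightarrow> complex" where
  "strip_map L z = - Ln (1 - of_real (strip_scale L) * z) / of_real L"

definition strip_series :: "real \<Rightarrow> complex fps" where
  "strip_series L = Abs_fps (\<lambda>k. of_real (strip_scale L ^ k / (real k * L)))"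

lemma strip_map_0 [simp]: "strip_map L 0 = 0"
  by (simp add: strip_map_def)

lemma strip_map_1:
  assumes "L > 0"
  shows "strip_map L 1 = 1"
proof -
  have "1 - complex_of_real (strip_scale L) = exp (of_real (- L))"
    by (simp add: strip_scale_def flip: exp_of_real)
  moreover have "Ln (exp (complex_of_real (- L))) = of_real (- L)"
    by (rule Ln_exp) (auto simp: pi_gt_zero)
  ultimately show ?thesis using assms by (simp add: strip_map_def)
qed

lemma strip_radius_gt_1: "L > 0 \<Longrightarrow> strip_radius L > 1"
  by (simp add: strip_radius_def less_divide_eq)

lemma strip_map_argument:
  assumes "L > 0" "norm z < strip_radius L"
  defines "u \<equiv> 1 - complex_of_real (strip_scale L) * z"
  shows "Re u > 0" "exp (- (L + 1)) < norm u" "norm u < 2"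
proof -
  have e: "exp (- L) < 1" using assms by simp
  have "norm (complex_of_real (strip_scale L) * z) = strip_scale L * norm z"
    using e by (simp add: norm_mult strip_scale_def del: of_real_diff)
  also have "\<dots> < 1 - exp (- (L + 1))"
    using assms(2) e by (simp add: strip_scale_def strip_radius_def less_divide_eq mult.commute)
  finally have s: "norm (complex_of_real (strip_scale L) * z) < 1 - exp (- (L + 1))" .
  show "exp (- (L + 1)) < norm u"
    using s norm_triangle_ineq2[of 1 "complex_of_real (strip_scale L) * z"] unfolding u_def by simp
  have pos: "exp (- (L + 1)) > 0" by simp
  show "norm u < 2"
    using s pos norm_triangle_ineq4[of 1 "complex_of_real (strip_scale L) * z"]
    unfolding u_def norm_one by linarith
  show "Re u > 0"
    using s pos complex_Re_le_cmod[of "complex_of_real (strip_scale L) * z"]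
    unfolding u_def minus_complex.sel one_complex.sel by linarith
qed

lemma strip_map_bounds:
  assumes "L > 0" "norm z < strip_radius L"
  shows "- (2 / L) \<le> Re (strip_map L z)" "Re (strip_map L z) \<le> 1 + 2 / L"
    "\<bar>Im (strip_map L z)\<bar> \<le> 2 / L"
proof -
  define u where "u = 1 - complex_of_real (strip_scale L) * z"
  note u = strip_map_argument[OF assms, folded u_def]
  have u0: "u \<noteq> 0" using u(1) by auto
  have sm: "strip_map L z = - Ln u / of_real L" by (simp add: strip_map_def u_def)
  have "ln (norm u) < ln 2" using u(3) u0 by simp
  also have "ln 2 \<le> (2 :: real)" using ln_2_less_1 by simp
  finally have "ln (norm u) \<le> 2" by simp
  then show "- (2 / L) \<le> Re (strip_map L z)"
    using assms(1) u0 by (simp add: sm Re_divide_of_real field_simps)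
  have "- (L + 1) < ln (norm u)"
    using u(2) u0 by (metis exp_less_cancel_iff exp_ln zero_less_norm_iff)
  then show "Re (strip_map L z) \<le> 1 + 2 / L"
    using assms(1) u0 by (simp add: sm Re_divide_of_real field_simps)
  have "\<bar>Im (Ln u)\<bar> < pi / 2" using u(1) by (rule Re_Ln_pos_lt_imp)
  then have "\<bar>Im (Ln u)\<bar> \<le> 2" using pi_less_4 by simp
  then show "\<bar>Im (strip_map L z)\<bar> \<le> 2 / L"
    using assms(1) by (simp add: sm Im_divide_of_real abs_divide divide_right_mono)
qed

lemma strip_map_holomorphic:
  assumes "L > 0"
  shows "strip_map L holomorphic_on ball 0 (strip_radius L)"
  unfolding strip_map_def [abs_def]
proof (intro holomorphic_intros)
  fix z :: complex assume "z \<in> ball 0 (strip_radius L)"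
  then have "Re (1 - of_real (strip_scale L) * z) > 0"
    by (intro strip_map_argument(1)[OF assms]) simp
  then show "1 - of_real (strip_scale L) * z \<notin> \<real>\<^sub>\<le>\<^sub>0"
    by (auto simp: complex_nonpos_Reals_iff)
qed (use assms in auto)

lemma strip_map_fps_expansion:
  assumes "L > 0"
  shows "strip_map L has_fps_expansion strip_series L"
proof (rule has_fps_expansionI)
  have "\<forall>\<^sub>F u in nhds 0. u \<in> ball (0 :: complex) 1"
    by (rule eventually_nhds_in_open) auto
  then show "\<forall>\<^sub>F u in nhds 0. (\<lambda>n. fps_nth (strip_series L) n * u ^ n) sums strip_map L u"
  proof eventually_elim
    case (elim u)
    have "0 \<le> strip_scale L" "strip_scale L \<le> 1" using assms by (auto simp: strip_scale_def)
    then have "norm (- (complex_of_real (strip_scale L) * u)) \<le> 1 * norm u"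
      by (simp add: norm_mult mult_left_le_one_le)
    then have "norm (- (complex_of_real (strip_scale L) * u)) < 1" using elim by simp
    from sums_mult[OF Ln_series'[OF this], of "- 1 / of_real L"]
    show ?case
      by (simp add: strip_map_def strip_series_def power_mult_distrib mult_ac)
  qed
qed

section \<open>The hafnian along a path of matrices\<close>

text \<open>Numbers in a thin rectangle around \<open>[\<delta>, 1]\<close> satisfy the hypotheses of
  \<open>matching_sum_nonzero\<close> with \<open>\<kappa> = 7/8 \<delta>\<^sup>2\<close>. The real part is at least
  \<open>(\<delta> - \<rho>)\<^sup>2 - \<rho>\<^sup>2 = \<delta>\<^sup>2 - 2 \<delta> \<rho> \<ge> \<delta>\<^sup>2 - \<delta>\<^sup>2 / 8\<close>, while the imaginary part is at most
  \<open>2 \<rho> (1 + \<rho>)\<close>, which is well below \<open>\<kappa> / 3\<close>.\<close>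
lemma rectangle_products:
  assumes \<delta>: "0 < \<delta>" "\<delta> \<le> 1" and \<rho>: "0 \<le> \<rho>" "\<rho> \<le> \<delta>\<^sup>2 / 16"
    and c: "\<delta> - \<rho> \<le> Re c" "Re c \<le> 1 + \<rho>" "\<bar>Im c\<bar> \<le> \<rho>"
    and d: "\<delta> - \<rho> \<le> Re d" "Re d \<le> 1 + \<rho>" "\<bar>Im d\<bar> \<le> \<rho>"
  shows "7 / 8 * \<delta>\<^sup>2 \<le> Re (c * cnj d)" "\<bar>Im (c * cnj d)\<bar> \<le> (7 / 8 * \<delta>\<^sup>2) / 3"
proof -
  have d1: "\<delta>\<^sup>2 \<le> \<delta>" "\<delta>\<^sup>2 \<le> 1" using \<delta> by (simp_all add: power2_eq_square mult_left_le mult_le_one)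
  have pos: "0 \<le> \<delta> - \<rho>" using \<delta> \<rho> d1 by linarith
  have "(\<delta> - \<rho>) * (\<delta> - \<rho>) \<le> Re c * Re d"
    using c d pos by (intro mult_mono) auto
  moreover have im: "\<bar>Im c * Im d\<bar> \<le> \<rho> * \<rho>"
    unfolding abs_mult using c d \<rho> by (intro mult_mono) auto
  moreover have "\<delta> * \<rho> \<le> 1 * (\<delta>\<^sup>2 / 16)"
    using \<delta> \<rho> by (intro mult_mono) auto
  moreover have "(\<delta> - \<rho>) * (\<delta> - \<rho>) - \<rho> * \<rho> = \<delta>\<^sup>2 - 2 * (\<delta> * \<rho>)"
    by (simp add: power2_eq_square algebra_simps)
  ultimately show "7 / 8 * \<delta>\<^sup>2 \<le> Re (c * cnj d)" by simp
  define b where "b = \<rho> * (1 + \<rho>)"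
  have "\<bar>Im c * Re d\<bar> \<le> b" "\<bar>Re c * Im d\<bar> \<le> b"
    unfolding abs_mult b_def mult.commute[of "\<bar>Re c\<bar>"]
    using c d \<rho> pos by (intro mult_mono; simp)+
  then have "\<bar>Im (c * cnj d)\<bar> \<le> 2 * b" by simp
  moreover have "b \<le> \<delta>\<^sup>2 / 16 * (17 / 16)"
    unfolding b_def using \<rho> d1 by (intro mult_mono) auto
  ultimately show "\<bar>Im (c * cnj d)\<bar> \<le> (7 / 8 * \<delta>\<^sup>2) / 3"
    using zero_le_power2[of \<delta>] by linarith
qed

text \<open>Since \<open>1 + s (a - 1)\<close> runs from \<open>1\<close> to \<open>a\<close> as \<open>s\<close> runs through \<open>[0, 1]\<close>, it stays near \<open>[\<delta>, 1]\<close>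
  for \<open>s\<close> near \<open>[0, 1]\<close>.\<close>
lemma interpolated_entry:
  assumes \<delta>: "0 < \<delta>" and a: "\<delta> \<le> a" "a \<le> 1" and \<rho>: "0 \<le> \<rho>"
    and s: "- \<rho> \<le> Re s" "Re s \<le> 1 + \<rho>" "\<bar>Im s\<bar> \<le> \<rho>"
  defines "c \<equiv> 1 + s * (of_real a - 1)"
  shows "\<delta> - \<rho> \<le> Re c" "Re c \<le> 1 + \<rho>" "\<bar>Im c\<bar> \<le> \<rho>"
proof -
  define t where "t = 1 - a"
  have t: "0 \<le> t" "t \<le> 1 - \<delta>" "t \<le> 1" using a \<delta> by (auto simp: t_def)
  have Re: "Re c = 1 - t * Re s" and Im: "Im c = - (t * Im s)"
    by (simp_all add: c_def t_def algebra_simps)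
  have "t * Re s \<le> t * (1 + \<rho>)" using t s by (intro mult_left_mono) auto
  moreover have "t * \<rho> \<le> 1 * \<rho>" using t \<rho> by (intro mult_right_mono) auto
  ultimately show "\<delta> - \<rho> \<le> Re c" using t by (simp add: Re algebra_simps)
  have "t * - \<rho> \<le> t * Re s" using t s by (intro mult_left_mono) auto
  with \<open>t * \<rho> \<le> 1 * \<rho>\<close> show "Re c \<le> 1 + \<rho>" by (simp add: Re)
  show "\<bar>Im c\<bar> \<le> \<rho>"
    using mult_mono[of t 1 "\<bar>Im s\<bar>" \<rho>] t s by (simp add: Im abs_mult)
qed

text \<open>The upper triangle of \<open>J + s (A - J)\<close>, where \<open>J\<close> is the all-ones matrix and \<open>x\<close> holds the entries
  of \<open>A\<close>.\<close>
definition path_weight :: "(nat \<times> nat \<Rightarrow> real) \<Rightarrow> complex \<Rightarrow> nat set \<Rightarrow> complex" where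
  "path_weight x s e = 1 + s * (of_real (x (Min e, Max e)) - 1)"

text \<open>The power series of \<open>haf (J + F (A - J)) / haf J\<close>, where the number of perfect matchings is
  \<open>haf J\<close>; the division makes the constant term \<open>1\<close>.\<close>
definition hafnian_series :: "complex fps \<Rightarrow> nat \<Rightarrow> (nat \<times> nat \<Rightarrow> real) \<Rightarrow> complex fps" where
  "hafnian_series F n x = fps_const (1 / of_nat (card (pair_partitions {0..<2*n}))) *
     matching_sum (\<lambda>e. 1 + F * fps_const (of_real (x (Min e, Max e)) - 1)) {0..<2*n}"

lemma matching_sum_1: "matching_sum (\<lambda>_. 1) S = of_nat (card (pair_partitions S))"
  by (simp add: matching_sum_def)

lemma card_pair_partitions_pos: "card (pair_partitions {0..<2 * n :: nat}) > 0"
proof -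
  have "matching_sum (\<lambda>_. 1 :: complex) {0..<2 * n} \<noteq> 0"
    by (rule matching_sum_nonzero[of 1 "{1}" _ n]) auto
  then show ?thesis by (simp add: matching_sum_1)
qed

lemma Min_Max_pair:
  assumes "e \<in> P" "P \<in> pair_partitions {0..<m}"
  shows "Min e < m" "Max e < m"
proof -
  have "e \<subseteq> {0..<m}" "card e = 2"
    using assms pair_partition_subset by (auto simp: pair_partitions_def)
  then have "finite e" "e \<noteq> {}" by (auto intro: card_ge_0_finite)
  then have "Min e \<in> e" "Max e \<in> e" by auto
  with \<open>e \<subseteq> _\<close> show "Min e < m" "Max e < m" by auto
qed

lemma graded_hafnian_series:
  assumes "\<And>k. fps_nth F k \<in> \<real>" "fps_nth F 0 = 0"
  shows "graded ({0..<2*n} \<times> {0..<2*n}) (hafnian_series F n)"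
  unfolding hafnian_series_def [abs_def] matching_sum_def
proof (intro graded_const_mult_linear graded_mult graded_sum graded_prod graded_add graded_1 assms)
  show "graded V (\<lambda>_. fps_const (1 / complex_of_nat (card (pair_partitions {0..<2 * n}))))" for V :: "(nat \<times> nat) set"
    by (rule graded_const) (auto intro: Reals_divide)
next
  fix P e assume "P \<in> pair_partitions {0..<2*n}" "e \<in> P"
  with Min_Max_pair show "(Min e, Max e) \<in> {0..<2*n} \<times> {0..<2*n}" by auto
qed

lemma fps_nth_0_prod: "fps_nth (\<Prod>i\<in>I. F i) 0 = (\<Prod>i\<in>I. fps_nth (F i) 0)"
  for F :: "'b \<Rightarrow> complex fps"
  by (induction I rule: infinite_finite_induct) simp_all

lemma hafnian_series_0:
  assumes "fps_nth F 0 = 0"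
  shows "fps_nth (hafnian_series F n x) 0 = 1"
  using card_pair_partitions_pos[of n] assms
  by (simp add: hafnian_series_def matching_sum_def fps_sum_nth fps_nth_0_prod)

text \<open>Let \<open>\<phi>\<close> be the map into the strip and \<open>Q(z) = haf (J + \<phi>(z) (A - J)) / haf J\<close>. All entries stay
  in the rectangle, so \<open>Q\<close> has no zeros on the disk and a holomorphic logarithm \<open>G\<close> there. Each entry has
  modulus at most \<open>2\<close>, hence \<open>|Q| \<le> 2\<^sup>n\<close> and \<open>Re G < n\<close>, which makes the Taylor coefficients of \<open>G\<close>
  decay geometrically with a factor linear in \<open>n\<close>. At \<open>z = 1\<close>, inside the disk, \<open>haf J exp (G(1))\<close> is
  the hafnian of \<open>A\<close>. The value \<open>L = 32 / \<delta>\<^sup>2\<close> makes the margin \<open>\<rho> = 2 / L\<close> equal to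
  \<open>\<delta>\<^sup>2 / 16\<close>.\<close>
lemma hafnian_log_truncation:
  assumes \<delta>: "0 < \<delta>" "\<delta> \<le> 1" and n: "n \<ge> 1"
    and x: "\<And>i j. i < 2*n \<Longrightarrow> j < 2*n \<Longrightarrow> \<delta> \<le> x (i, j) \<and> x (i, j) \<le> 1"
  defines "L \<equiv> 32 / \<delta>\<^sup>2"
  assumes r: "1 < r" "r < strip_radius L"
  defines "N \<equiv> card (pair_partitions {0..<2*n})"
  shows "\<bar>ln (matching_sum (\<lambda>e. x (Min e, Max e)) {0..<2*n}) -
      (ln (real N) + Re (\<Sum>k\<le>d. fps_nth (fps_log (hafnian_series (strip_series L) n x)) k))\<bar>
    \<le> 2 * real n * r / ((strip_radius L - r) * (r ^ d * (r - 1)))"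
proof -
  define S where "S = {0..<2*n}"
  define R where "R = strip_radius L"
  define \<phi> where "\<phi> = strip_map L"
  define \<rho> where "\<rho> = 2 / L"
  define Q where "Q = (\<lambda>z. 1 / of_nat N * matching_sum (path_weight x (\<phi> z)) S)"
  define QF where "QF = hafnian_series (strip_series L) n x"
  have L: "L > 0" using \<delta> by (simp add: L_def)
  have \<rho>: "0 \<le> \<rho>" "\<rho> \<le> \<delta>\<^sup>2 / 16" using \<delta> by (auto simp: \<rho>_def L_def)
  have \<rho>1: "\<rho> \<le> 1 / 16"
    using \<rho>(2) \<delta> power_le_one[of \<delta> 2] by simp
  have N: "N > 0" using card_pair_partitions_pos by (simp add: N_def)
  have S: "finite S" "card S = 2 * n" by (auto simp: S_def)
  define K where "K = {c. \<delta> - \<rho> \<le> Re c \<and> Re c \<le> 1 + \<rho> \<and> \<bar>Im c\<bar> \<le> \<rho>}"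
  have wK: "path_weight x (\<phi> z) e \<in> K"
    if "norm z < R" "Min e < 2*n" "Max e < 2*n" for z e
    using interpolated_entry[OF \<delta>(1) _ _ \<rho>(1) strip_map_bounds[OF L, folded \<rho>_def],
        of "x (Min e, Max e)" z] x that
    by (auto simp: K_def path_weight_def \<phi>_def R_def)
  have Q_nz: "Q z \<noteq> 0" if z: "norm z < R" for z
  proof -
    have "matching_sum (path_weight x (\<phi> z)) S \<noteq> 0"
    proof (rule matching_sum_nonzero[of "7 / 8 * \<delta>\<^sup>2" K _ n])
      fix i j assume "i \<in> S" "j \<in> S" "i \<noteq> j"
      then show "path_weight x (\<phi> z) {i, j} \<in> K"
        by (intro wK z) (auto simp: S_def)
    qed (use rectangle_products[OF \<delta> \<rho>] \<delta> S in \<open>auto simp: K_def\<close>)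
    then show ?thesis using N by (simp add: Q_def)
  qed
  have Q_le: "norm (Q z) \<le> 2 ^ n" if z: "norm z < R" for z
  proof -
    have "norm (matching_sum (path_weight x (\<phi> z)) S) \<le> (\<Sum>P\<in>pair_partitions S. 2 ^ n)"
      unfolding matching_sum_def
    proof (rule sum_norm_le)
      fix P assume P: "P \<in> pair_partitions S"
      have "norm (\<Prod>e\<in>P. path_weight x (\<phi> z) e) \<le> (\<Prod>e\<in>P. 2)"
        unfolding prod_norm[symmetric]
      proof (intro prod_mono conjI norm_ge_zero)
        fix e assume e: "e \<in> P"
        have "path_weight x (\<phi> z) e \<in> K"
          using Min_Max_pair[OF e, of "2*n"] P by (intro wK z) (auto simp: S_def)
        moreover have "\<rho> \<le> \<delta>"
        proof -
          have "\<delta>\<^sup>2 \<le> \<delta>" using \<delta> by (simp add: power2_eq_square mult_left_le)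
          then show ?thesis using \<rho>(2) \<delta> by linarith
        qed
        ultimately show "norm (path_weight x (\<phi> z) e) \<le> 2"
          using cmod_le[of "path_weight x (\<phi> z) e"] \<rho>1 by (auto simp: K_def)
      qed
      also have "\<dots> = 2 ^ n"
        using card_pair_partition[OF S(1) P] S(2) by simp
      finally show "norm (\<Prod>e\<in>P. path_weight x (\<phi> z) e) \<le> 2 ^ n" .
    qed
    then show ?thesis using N by (simp add: Q_def N_def S_def norm_mult norm_divide field_simps)
  qed
  have Q_hol: "Q holomorphic_on ball 0 R"
    unfolding Q_def matching_sum_def path_weight_def \<phi>_def R_def
    by (intro holomorphic_intros strip_map_holomorphic[OF L])
  have Q_fps: "Q has_fps_expansion QF"
    unfolding Q_def QF_def hafnian_series_def matching_sum_def path_weight_def \<phi>_def N_def S_def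
    by (intro has_fps_expansion_cmult_left fps_expansion_intros strip_map_fps_expansion[OF L])
  have Q0: "Q 0 = 1"
  proof -
    have "path_weight x (\<phi> 0) = (\<lambda>_. 1)" by (simp add: path_weight_def \<phi>_def fun_eq_iff)
    then show ?thesis using N by (simp add: Q_def matching_sum_1 N_def S_def)
  qed
  have F0: "fps_nth (strip_series L) 0 = 0" by (simp add: strip_series_def)
  have QF0: "fps_nth QF 0 = 1" by (simp add: QF_def hafnian_series_0[OF F0])
  have R1: "R > 1" using strip_radius_gt_1[OF L] by (simp add: R_def)

  obtain G0 where G0: "G0 holomorphic_on ball 0 R" "\<And>z. z \<in> ball 0 R \<Longrightarrow> Q z = exp (G0 z)"
    using contractible_imp_holomorphic_log[OF Q_hol] Q_nz
      convex_imp_contractible[OF convex_ball] by (metis mem_ball_0)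
  define G where "G = (\<lambda>z. G0 z - G0 0)"
  have G_hol: "G holomorphic_on ball 0 R"
    unfolding G_def by (intro holomorphic_intros G0(1))
  have "exp (G0 0) = 1" using G0(2)[of 0] R1 Q0 by simp
  then have Q_exp: "Q z = exp (G z)" if "norm z < R" for z
    using G0(2)[of z] that by (simp add: G_def exp_diff)
  have G_0: "G 0 = 0" by (simp add: G_def)
  define F where "F = fps_expansion G 0"
  have F: "G has_fps_expansion F"
    unfolding F_def using G_hol R1 by (intro has_fps_expansion_fps_expansion) auto
  \<comment> \<open>\<open>Q' = G' Q\<close> identifies the Taylor series of \<open>G\<close> with the formal logarithm, whose coefficients
    are known to be polynomials in the entries.\<close>
  have "F = fps_log QF"
  proof (rule fps_log_unique)
    show "fps_nth QF 0 \<noteq> 0" by (simp add: QF0)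
    show "fps_nth F 0 = 0" using fps_nth_fps_expansion[OF F, of 0] G_0 by simp
    have "(\<lambda>z. deriv G z * Q z) has_fps_expansion fps_deriv F * QF"
      by (intro fps_expansion_intros F Q_fps)
    moreover have "deriv Q has_fps_expansion fps_deriv QF"
      by (intro fps_expansion_intros Q_fps)
    moreover have "\<forall>\<^sub>F z in nhds 0. deriv Q z = deriv G z * Q z"
    proof -
      have "\<forall>\<^sub>F z in nhds 0. z \<in> ball 0 R"
        using R1 by (intro eventually_nhds_in_open) auto
      then show ?thesis
      proof eventually_elim
        case (elim z)
        have "(G has_field_derivative deriv G z) (at z)"
          using G_hol elim by (intro holomorphic_derivI[of _ "ball 0 R"]) auto
        then have "((\<lambda>z. exp (G z)) has_field_derivative exp (G z) * deriv G z) (at z)"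
          by (rule DERIV_fun_exp)
        then have "(Q has_field_derivative exp (G z) * deriv G z) (at z)"
          by (rule has_field_derivative_transform_within_open[of _ _ _ "ball 0 R"])
            (use elim Q_exp in auto)
        then show ?case using elim Q_exp by (simp add: DERIV_imp_deriv mult.commute)
      qed
    qed
    ultimately show "fps_deriv F * QF = fps_deriv QF"
      by (metis fps_expansion_unique_complex has_fps_expansion_cong)
  qed
  have G_re: "Re (G z) < real n" if z: "norm z < R" for z
  proof -
    have "exp (Re (G z)) = norm (Q z)" using Q_exp[OF z] by simp
    also have "\<dots> \<le> 2 ^ n" by (rule Q_le[OF z])
    also have "\<dots> < exp 1 ^ n"
    proof (intro power_strict_mono)
      show "2 < exp (1 :: real)"
        using ln_2_less_1 exp_less_mono[of "ln 2" "1 :: real"] by simp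
    qed (use n in auto)
    also have "\<dots> = exp (real n)" by (simp flip: exp_of_nat_mult)
    finally show ?thesis by simp
  qed
  have "(\<lambda>k. fps_nth F k * 1 ^ k) sums G 1"
    by (rule has_fps_expansion_imp_sums_complex[OF F, of "ereal R"]) (use G_hol R1 in auto)
  then have sums: "fps_nth F sums G 1" by simp
  have "norm (G 1 - (\<Sum>k\<le>d. fps_nth F k)) \<le> 2 * real n * r / (R - r) / (r ^ d * (r - 1))"
    using r by (intro power_series_tail[OF sums] coeff_bound_of_Re_bound[OF G_hol G_0 G_re _ _ F])
      (auto simp: R_def)
  then have tail: "\<bar>Re (G 1) - Re (\<Sum>k\<le>d. fps_nth F k)\<bar>
      \<le> 2 * real n * r / ((R - r) * (r ^ d * (r - 1)))"
    using abs_Re_le_cmod[of "G 1 - (\<Sum>k\<le>d. fps_nth F k)"] by simp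

  let ?h = "matching_sum (\<lambda>e. x (Min e, Max e)) S"
  have "of_real ?h = matching_sum (path_weight x (\<phi> 1)) S"
    by (simp add: matching_sum_def path_weight_def \<phi>_def strip_map_1[OF L])
  also have "\<dots> = of_nat N * exp (G 1)"
    using Q_exp[of 1] R1 N by (simp add: Q_def field_simps)
  finally have "norm (complex_of_real ?h) = norm (of_nat N * exp (G 1))" by simp
  then have abs_h: "\<bar>?h\<bar> = real N * exp (Re (G 1))" by (simp add: norm_mult)
  have "?h \<ge> 0"
    unfolding matching_sum_def
  proof (intro sum_nonneg prod_nonneg)
    fix P e assume "P \<in> pair_partitions S" "e \<in> P"
    then have "\<delta> \<le> x (Min e, Max e)"
      using Min_Max_pair[of e P "2 * n"] x by (simp add: S_def)
    then show "0 \<le> x (Min e, Max e)" using \<delta> by simp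
  qed
  with abs_h have "ln ?h = ln (real N) + Re (G 1)"
    using N by (simp add: ln_mult)
  with tail show ?thesis
    by (simp add: \<open>F = fps_log QF\<close> QF_def R_def S_def)
qed

section \<open>Polynomial approximation of the logarithm of the hafnian\<close>
theorem theorem2p2:
  fixes \<delta> :: real
  assumes "0 < \<delta>" and "\<delta> \<le> 1"
  shows "\<exists>\<gamma>::real. \<gamma> > 0 \<and>
    (\<forall>(n::nat) (\<epsilon>::real). n \<ge> 1 \<longrightarrow> 0 < \<epsilon> \<longrightarrow> \<epsilon> < 1 \<longrightarrow>
      (\<exists>p :: (nat \<times> nat, real) mpoly.
        mpoly_vars p \<subseteq> {0..<2*n} \<times> {0..<2*n} \<and>
        (n \<ge> 2 \<longrightarrow> real (mpoly_degree p) \<le> \<gamma> * (ln (real n) - ln \<epsilon>)) \<and>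
        (n = 1 \<longrightarrow> real (mpoly_degree p) \<le> \<gamma> * (1 - ln \<epsilon>)) \<and>
        (\<forall>A :: real mat. A \<in> carrier_mat (2*n) (2*n) \<longrightarrow> transpose_mat A = A \<longrightarrow>
          (\<forall>i<2*n. \<forall>j<2*n. \<delta> \<le> A $$ (i, j) \<and> A $$ (i, j) \<le> 1) \<longrightarrow>
          \<bar>ln (hafnian A) - mpoly_eval (\<lambda>ij. A $$ ij) p\<bar> \<le> \<epsilon>)))"
proof -
  define L where "L = 32 / \<delta>\<^sup>2"
  have L: "L > 0" using assms by (simp add: L_def)
  obtain r where r: "1 < r" "r < strip_radius L"
    using dense[OF strip_radius_gt_1[OF L]] by blast
  \<comment> \<open>The maximum with \<open>1\<close> makes \<open>ln B\<close> nonnegative, so that it can be absorbed into a multiple of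
    any \<open>t \<ge> ln 2\<close>.\<close>
  define B where "B = max 1 (2 * r / ((strip_radius L - r) * (r - 1)))"
  define \<gamma> where "\<gamma> = (ln B / ln 2 + 1) / ln r + 1 / ln 2"
  have B: "1 \<le> B" "2 * r / ((strip_radius L - r) * (r - 1)) \<le> B" by (auto simp: B_def)
  have lr: "ln r > 0" using r by simp
  have \<gamma>: "\<gamma> > 0"
    unfolding \<gamma>_def using B lr by (intro add_nonneg_pos divide_nonneg_pos) auto
  show ?thesis
  proof (intro exI[of _ \<gamma>] conjI \<gamma> allI impI)
    fix n :: nat and \<epsilon> :: real
    assume n: "n \<ge> 1" and \<epsilon>: "0 < \<epsilon>" "\<epsilon> < 1"
    define V where "V = {0..<2*n} \<times> {0..<2*n}"
    define d where "d = nat \<lceil>(ln B + (ln (real n) - ln \<epsilon>)) / ln r\<rceil>"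
    have ln_n: "0 \<le> ln (real n)" and ln_\<epsilon>: "ln \<epsilon> < 0" using n \<epsilon> by auto
    have arg0: "0 \<le> (ln B + (ln (real n) - ln \<epsilon>)) / ln r"
      using B lr ln_n ln_\<epsilon> by (intro divide_nonneg_pos add_nonneg_nonneg) auto
    have d_ge: "(ln B + (ln (real n) - ln \<epsilon>)) / ln r \<le> real d"
      unfolding d_def by (rule real_nat_ceiling_ge)
    \<comment> \<open>Here \<open>t\<close> stands for \<open>ln n - ln \<epsilon>\<close> if \<open>n \<ge> 2\<close> and for \<open>1 - ln \<epsilon>\<close> if \<open>n = 1\<close>.\<close>
    have d_le: "real d \<le> \<gamma> * t" if t: "ln 2 \<le> t" "ln (real n) - ln \<epsilon> \<le> t" for t
    proof -
      have t1: "1 \<le> t / ln 2" using t(1) by simp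
      have "real d \<le> (ln B + (ln (real n) - ln \<epsilon>)) / ln r + 1"
        unfolding d_def using arg0 by (simp add: of_nat_nat)
      also have "\<dots> \<le> (ln B * (t / ln 2) + t) / ln r + t / ln 2"
        using t t1 B lr mult_left_mono[OF t1, of "ln B"]
        by (intro add_mono divide_right_mono) auto
      also have "\<dots> = \<gamma> * t"
        by (simp add: \<gamma>_def algebra_simps add_divide_distrib)
      finally show ?thesis .
    qed
    have err: "2 * real n * r / ((strip_radius L - r) * (r ^ d * (r - 1))) \<le> \<epsilon>"
    proof -
      have "ln B + ln (real n) - ln \<epsilon> \<le> real d * ln r"
        using d_ge lr by (simp add: divide_le_eq)
      then have "ln (B * real n / \<epsilon>) \<le> ln (r ^ d)"
        using B n \<epsilon> r by (simp add: ln_mult ln_div ln_realpow)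
      then have "B * real n / \<epsilon> \<le> r ^ d"
        using B n \<epsilon> r by (subst (asm) ln_le_cancel_iff) auto
      then have *: "B * real n / r ^ d \<le> \<epsilon>"
        using \<epsilon> r by (simp add: field_simps)
      have "2 * real n * r / ((strip_radius L - r) * (r ^ d * (r - 1)))
          = 2 * r / ((strip_radius L - r) * (r - 1)) * (real n / r ^ d)"
        by (simp add: mult_ac)
      also have "\<dots> \<le> B * (real n / r ^ d)"
        using B r by (intro mult_right_mono) auto
      finally show ?thesis using * by simp
    qed
    define N where "N = card (pair_partitions {0..<2*n})"
    define coeff where "coeff = (\<lambda>x k. fps_nth (fps_log (hafnian_series (strip_series L) n x)) k)"
    have "graded V (\<lambda>x. fps_log (hafnian_series (strip_series L) n x))"
      unfolding V_def
      by (intro graded_fps_log graded_hafnian_series hafnian_series_0)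
         (auto simp: strip_series_def)
    then have "real_poly_fun V d (\<lambda>x. of_real (ln (real N)) + (\<Sum>k\<le>d. coeff x k))"
      unfolding coeff_def graded_def
      by (intro real_poly_fun_add real_poly_fun_const real_poly_fun_sum)
         (auto intro: real_poly_fun_mono)
    then obtain p :: "(nat \<times> nat, real) mpoly" where p: "mpoly_vars p \<subseteq> V" "mpoly_degree p \<le> d"
      "\<And>x. of_real (ln (real N)) + (\<Sum>k\<le>d. coeff x k) = complex_of_real (mpoly_eval x p)"
      unfolding real_poly_fun_def by blast
    have deg: "real (mpoly_degree p) \<le> \<gamma> * t" if "ln 2 \<le> t" "ln (real n) - ln \<epsilon> \<le> t" for t
      using d_le[OF that] p(2) by linarith
    show "\<exists>p :: (nat \<times> nat, real) mpoly.
        mpoly_vars p \<subseteq> {0..<2*n} \<times> {0..<2*n} \<and>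
        (n \<ge> 2 \<longrightarrow> real (mpoly_degree p) \<le> \<gamma> * (ln (real n) - ln \<epsilon>)) \<and>
        (n = 1 \<longrightarrow> real (mpoly_degree p) \<le> \<gamma> * (1 - ln \<epsilon>)) \<and>
        (\<forall>A :: real mat. A \<in> carrier_mat (2*n) (2*n) \<longrightarrow> transpose_mat A = A \<longrightarrow>
          (\<forall>i<2*n. \<forall>j<2*n. \<delta> \<le> A $$ (i, j) \<and> A $$ (i, j) \<le> 1) \<longrightarrow>
          \<bar>ln (hafnian A) - mpoly_eval (\<lambda>ij. A $$ ij) p\<bar> \<le> \<epsilon>)"
    proof (intro exI[of _ p] conjI allI impI)
      show "mpoly_vars p \<subseteq> {0..<2*n} \<times> {0..<2*n}" using p(1) by (simp add: V_def)
    next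
      assume "n \<ge> 2"
      then have "ln 2 \<le> ln (real n)" by simp
      then show "real (mpoly_degree p) \<le> \<gamma> * (ln (real n) - ln \<epsilon>)"
        using ln_\<epsilon> by (intro deg) auto
    next
      assume "n = 1"
      then show "real (mpoly_degree p) \<le> \<gamma> * (1 - ln \<epsilon>)"
        using ln_\<epsilon> ln_2_less_1 by (intro deg) auto
    next
      fix A :: "real mat"
      assume A: "A \<in> carrier_mat (2*n) (2*n)"
        "\<forall>i<2*n. \<forall>j<2*n. \<delta> \<le> A $$ (i, j) \<and> A $$ (i, j) \<le> 1"
      define x where "x = (\<lambda>ij. A $$ ij)"
      have "hafnian A = matching_sum (\<lambda>e. x (Min e, Max e)) {0..<2*n}"
        using A(1) by (simp add: hafnian_def matching_sum_def x_def)
      moreover have "mpoly_eval x p = ln (real N) + Re (\<Sum>k\<le>d. coeff x k)"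
        using arg_cong[OF p(3)[of x], of Re] by simp
      moreover have "\<bar>ln (matching_sum (\<lambda>e. x (Min e, Max e)) {0..<2*n}) -
          (ln (real N) + Re (\<Sum>k\<le>d. coeff x k))\<bar> \<le> \<epsilon>"
        using hafnian_log_truncation[OF assms n, of x r d, folded L_def N_def] A(2) r err
        by (auto simp: x_def coeff_def)
      ultimately show "\<bar>ln (hafnian A) - mpoly_eval (\<lambda>ij. A $$ ij) p\<bar> \<le> \<epsilon>"
        by (simp add: x_def)
    qed
  qed
qed

end
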